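(* Let $\nu$ be an initial distribution on $E$ and let $H:P(\mathbb{R})\to\mathbb{R}$ be Lipschitz-continuous with respect to the Wasserstein distance $W_1$, i.e. there exists $K>0$ such that $|H(F)-H(G)|\le K\cdot W_1(F,G)$ for all $F,G\in P(\mathbb{R})$. Then: a) The infinite horizon problem can be approximated by the finite horizon problems: $$\lim_{N\to\infty}\sup_{\sigma\in\Pi_\infty}H(F_N^\sigma)=\sup_{\sigma\in\Pi_\infty}\lim_{N\to\infty}H(F_N^\sigma)=\sup_{\sigma\in\Pi_\infty}H(F_\infty^\sigma).$$ b) There exists an optimal policy $\sigma^*=(\sigma_0^*,\sigma_1^*,\ldots)\in\Pi_\infty$ for the problem $\sup_{\sigma\in\Pi_\infty}H(F_\infty^\sigma)$, i.e. $H(F_\infty^{\sigma^*})=\sup_{\sigma\in\Pi_\infty}H(F_\infty^\sigma)$, and $\emptyset\ne Ls\,A_N\subset A_\infty$.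
   Context: Infinite-horizon discounted MDP: $E$ is a finite nonempty state space, $A$ a finite nonempty action space, $r:E\times A\to\mathbb{R}$ the one-stage reward, $q(\cdot|x,a)$ a transition probability from $E\times A$ to $E$, $\beta\in(0,1)$ a discount factor. $P(Y)$ denotes the set of probability distributions on $Y$. Histories: $\mathcal{H}_0=E$, $\mathcal{H}_n=E\times(A\times E)^n$, with elements $h_n=(x_0,a_0,\ldots,x_n)$, and $\mathcal{H}=\bigcup_{n\ge0}\mathcal{H}_n$ (countable). A policy is a sequence $\sigma=(\sigma_0,\sigma_1,\ldots)$ of decision rules $\sigma_n:\mathcal{H}_n\to P(A)$; $\Pi_\infty$ is the set of all policies, identified with $P(A)^{\mathcal{H}}$ and equipped with the product topology. $\nu,\sigma,q$ define in the standard way a unique probability measure $\mathbb{P}_\nu^\sigma$ on $(E\times A)^\infty$ (with the $\sigma$-algebra generated by cylinders), under which the coordinate processes $X_n$ (states), $A_n$ (actions) satisfy $X_0\sim\nu$, $A_n$ has conditional law $\sigma_n(\cdot|h_n)$ given history $h_n$, and $X_{n+1}$ has conditional law $q(\cdot|x_n,a_n)$ given $(h_n,a_n)$. Rewards: $R_n=\sum_{k=0}^n\beta^k r(X_k,A_k)$ and $R_\infty=\lim_{n\to\infty}R_n$. $F_N^\sigma=\mathbb{P}_\nu^\sigma(R_N\in\cdot)$ and $F_\infty^\sigma=\mathbb{P}_\nu^\sigma(R_\infty\in\cdot)$ are the distributions of $R_N$ and $R_\infty$ under $\mathbb{P}_\nu^\sigma$. $W_1(F,G)=\inf\mathbb{E}|X-Y|\in[0,\infty]$,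 the infimum being over all couplings $(X,Y)$ with $X\sim F$, $Y\sim G$. Sets of optimal policies: $A_N=\{\sigma\in\Pi_\infty: H(F_N^\sigma)=\sup_{\sigma'\in\Pi_\infty}H(F_N^{\sigma'})\}$ for $N\in\mathbb{N}$, $A_\infty=\{\sigma\in\Pi_\infty: H(F_\infty^\sigma)=\sup_{\sigma'\in\Pi_\infty}H(F_\infty^{\sigma'})\}$ (not to be confused with the action variables $A_n$), and $$Ls\,A_N=\{\sigma\in\Pi_\infty:\ \sigma\text{ is an accumulation point of a sequence }(\sigma^N)_{N\in\mathbb{N}}\text{ with }\sigma^N\in A_N\text{ for all }N\},$$ where an accumulation point of a sequence means a limit of a subsequence. *)

theory Defs
  imports "HOL-Probability.Probability"
begin

section \<open>Policies\<close>

text \<open>The state space \<open>E\<close> and the action space \<open>A\<close> are finite types. A history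
  \<open>(x\<^sub>0, a\<^sub>0, x\<^sub>1, \<dots>, a\<^sub>n\<^sub>-\<^sub>1, x\<^sub>n)\<close> is encoded as \<open>(x\<^sub>0, [(a\<^sub>0, x\<^sub>1), \<dots>, (a\<^sub>n\<^sub>-\<^sub>1, x\<^sub>n)])\<close>,
  so this type is the disjoint union of all \<open>E \<times> (A \<times> E)\<^sup>n\<close>. A policy assigns a distribution on
  \<open>A\<close> to every history; its restriction to histories with a list of length \<open>n\<close> is the decision
  rule \<open>\<sigma>\<^sub>n\<close>.\<close>

type_synonym ('e, 'a) hist = "'e \<times> ('a \<times> 'e) list"
type_synonym ('e, 'a) policy = "('e, 'a) hist \<Rightarrow> 'a pmf"

text \<open>\<open>P(A)\<close> carries the topology of the simplex in \<open>\<real>\<^sup>A\<close> (\<open>A\<close> being finite), and \<open>P(A)\<^sup>H\<close> the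
  product topology.\<close>

definition pmf_topology :: "'a::finite pmf topology" where
  "pmf_topology = pullback_topology UNIV pmf euclidean"

definition policy_topology :: "('e, 'a::finite) policy topology" where
  "policy_topology = product_topology (\<lambda>_. pmf_topology) UNIV"

section \<open>The controlled process\<close>

text \<open>\<open>step_pmf \<nu> q \<sigma> n \<omega>\<close> is the law of \<open>(X\<^sub>n, A\<^sub>n)\<close> given \<open>(X\<^sub>k, A\<^sub>k) = \<omega> k\<close> for \<open>k < n\<close>: first draw
  the state \<open>x\<close> (from \<open>\<nu>\<close>, or from \<open>q\<close> at the preceding state-action pair), then draw the action
  from the policy at the history which ends in \<open>x\<close>.\<close>

definition step_pmf ::
  "'e pmf \<Rightarrow> ('e \<times> 'a \<Rightarrow> 'e pmf) \<Rightarrow> ('e, 'a) policy \<Rightarrow> nat \<Rightarrow> (nat \<Rightarrow> 'e \<times> 'a) \<Rightarrow> ('e \<times> 'a) pmf" where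
  "step_pmf \<nu> q \<sigma> n \<omega> =
    (case n of
       0 \<Rightarrow> bind_pmf \<nu> (\<lambda>x. map_pmf (Pair x) (\<sigma> (x, [])))
     | Suc m \<Rightarrow> bind_pmf (q (\<omega> m)) (\<lambda>x. map_pmf (Pair x)
         (\<sigma> (fst (\<omega> 0), map (\<lambda>k. (snd (\<omega> k), fst (\<omega> (Suc k)))) [0..<m] @ [(snd (\<omega> m), x)]))))"

text \<open>The measure \<open>\<P>\<^sub>\<nu>\<^sup>\<sigma>\<close> on \<open>(E \<times> A)\<^sup>\<infinity>\<close>, obtained from these kernels by the Ionescu-Tulcea
  theorem; \<open>measure_mdp_cylinder\<close> below gives its values on cylinders.\<close>

definition mdp_measure ::
  "'e pmf \<Rightarrow> ('e \<times> 'a \<Rightarrow> 'e pmf) \<Rightarrow> ('e, 'a) policy \<Rightarrow> (nat \<Rightarrow> 'e \<times> 'a) measure" where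
  "mdp_measure \<nu> q \<sigma> =
    projective_family.lim UNIV
      (Ionescu_Tulcea.CI (\<lambda>n \<omega>. measure_pmf (step_pmf \<nu> q \<sigma> n \<omega>)) (\<lambda>_. count_space UNIV))
      (\<lambda>_. count_space UNIV)"

definition reward :: "('e \<times> 'a \<Rightarrow> real) \<Rightarrow> real \<Rightarrow> nat \<Rightarrow> (nat \<Rightarrow> 'e \<times> 'a) \<Rightarrow> real" where
  "reward r \<beta> n \<omega> = (\<Sum>k\<le>n. \<beta> ^ k * r (\<omega> k))"

definition reward_inf :: "('e \<times> 'a \<Rightarrow> real) \<Rightarrow> real \<Rightarrow> (nat \<Rightarrow> 'e \<times> 'a) \<Rightarrow> real" where
  "reward_inf r \<beta> \<omega> = lim (\<lambda>n. reward r \<beta> n \<omega>)"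

definition reward_law ::
  "'e pmf \<Rightarrow> ('e \<times> 'a \<Rightarrow> 'e pmf) \<Rightarrow> ('e \<times> 'a \<Rightarrow> real) \<Rightarrow> real \<Rightarrow> nat \<Rightarrow> ('e, 'a) policy \<Rightarrow> real measure" where
  "reward_law \<nu> q r \<beta> N \<sigma> = distr (mdp_measure \<nu> q \<sigma>) borel (reward r \<beta> N)"

definition reward_law_inf ::
  "'e pmf \<Rightarrow> ('e \<times> 'a \<Rightarrow> 'e pmf) \<Rightarrow> ('e \<times> 'a \<Rightarrow> real) \<Rightarrow> real \<Rightarrow> ('e, 'a) policy \<Rightarrow> real measure" where
  "reward_law_inf \<nu> q r \<beta> \<sigma> = distr (mdp_measure \<nu> q \<sigma>) borel (reward_inf r \<beta>)"

section \<open>Wasserstein distance\<close>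

text \<open>\<open>P(\<real>)\<close> is \<open>space (prob_algebra borel)\<close>, the set of Borel probability measures. A coupling is
  represented by its joint law.\<close>

definition couplings :: "real measure \<Rightarrow> real measure \<Rightarrow> (real \<times> real) measure set" where
  "couplings F G = {\<pi> \<in> space (prob_algebra (borel \<Otimes>\<^sub>M borel)). distr \<pi> borel fst = F \<and> distr \<pi> borel snd = G}"

definition wasserstein1 :: "real measure \<Rightarrow> real measure \<Rightarrow> ennreal" where
  "wasserstein1 F G = (INF \<pi>\<in>couplings F G. \<integral>\<^sup>+p. ennreal \<bar>fst p - snd p\<bar> \<partial>\<pi>)"

section \<open>Optimal policies\<close>

text \<open>Suprema are taken in \<open>ereal\<close>: on \<open>real\<close> the supremum of an unbounded set is a meaningless
  default value.\<close>

definition optimal_policies :: "(('e, 'a) policy \<Rightarrow> real) \<Rightarrow> ('e, 'a) policy set" where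
  "optimal_policies J = {\<sigma>. ereal (J \<sigma>) = (SUP \<sigma>'. ereal (J \<sigma>'))}"

definition Ls :: "(nat \<Rightarrow> ('e, 'a::finite) policy set) \<Rightarrow> ('e, 'a) policy set" where
  "Ls \<A> = {\<sigma>. \<exists>s. (\<forall>N. s N \<in> \<A> N) \<and>
      (\<exists>\<phi>. strict_mono \<phi> \<and> limitin policy_topology (s \<circ> \<phi>) \<sigma> sequentially)}"

section \<open>Basic facts\<close>

lemma limitin_policy_topology_iff:
  "limitin policy_topology (s :: _ \<Rightarrow> ('a, 'b::finite) policy) \<sigma> F \<longleftrightarrow>
    (\<forall>h a. ((\<lambda>N. pmf (s N h) a) \<longlongrightarrow> pmf (\<sigma> h) a) F)"
proof -
  have *: "limitin pmf_topology t p F \<longleftrightarrow> (\<forall>a. ((\<lambda>N. pmf (t N) a) \<longlongrightarrow> pmf p a) F)"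
    for t :: "_ \<Rightarrow> 'b pmf" and p
  proof -
    have "limitin pmf_topology t p F \<longleftrightarrow> ((\<lambda>N. pmf (t N)) \<longlongrightarrow> pmf p) F"
    proof -
      have "limitin pmf_topology t p F \<longleftrightarrow>
          (\<forall>U. (\<exists>V. open V \<and> U = pmf -` V) \<and> p \<in> U \<longrightarrow> eventually (\<lambda>x. t x \<in> U) F)"
        by (simp add: limitin_def pmf_topology_def topspace_pullback_topology openin_pullback_topology)
      also have "\<dots> \<longleftrightarrow> ((\<lambda>N. pmf (t N)) \<longlongrightarrow> pmf p) F"
        by (auto simp: tendsto_def)
      finally show ?thesis .
    qed
    also have "\<dots> \<longleftrightarrow> (\<forall>a. ((\<lambda>N. pmf (t N) a) \<longlongrightarrow> pmf p a) F)"
      using limitin_componentwise[of "\<lambda>_. euclidean" UNIV "\<lambda>N. pmf (t N)" "pmf p" F]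
      by (simp add: euclidean_product_topology)
    finally show ?thesis .
  qed
  have "topspace pmf_topology = (UNIV :: 'b pmf set)"
    by (simp add: pmf_topology_def topspace_pullback_topology)
  then show ?thesis
    by (simp add: policy_topology_def limitin_componentwise *)
qed

lemma step_pmf_cong:
  assumes "\<And>k. k < n \<Longrightarrow> \<omega> k = \<omega>' k"
  shows "step_pmf \<nu> q \<sigma> n \<omega> = step_pmf \<nu> q \<sigma> n \<omega>'"
proof (cases n)
  case (Suc m)
  have "map (\<lambda>k. (snd (\<omega> k), fst (\<omega> (Suc k)))) [0..<m] = map (\<lambda>k. (snd (\<omega>' k), fst (\<omega>' (Suc k)))) [0..<m]"
    using Suc assms by (intro map_cong) auto
  then show ?thesis
    using Suc assms[of 0] assms[of m] by (simp add: step_pmf_def del: map_eq_conv)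
qed (simp add: step_pmf_def)

lemma Ionescu_Tulcea_mdp:
  fixes \<nu> :: "'e::finite pmf" and q :: "'e \<times> 'a::finite \<Rightarrow> 'e pmf"
  shows "Ionescu_Tulcea (\<lambda>n \<omega>. measure_pmf (step_pmf \<nu> q \<sigma> n \<omega>)) (\<lambda>_. count_space UNIV)"
proof
  fix i
  have "(PiM {0..<i} (\<lambda>_. count_space UNIV) :: (nat \<Rightarrow> 'e \<times> 'a) measure) = count_space (PiE {0..<i} (\<lambda>_. UNIV))"
    by (rule count_space_PiM_finite) auto
  then show "(\<lambda>\<omega>. measure_pmf (step_pmf \<nu> q \<sigma> i \<omega>))
      \<in> measurable (PiM {0..<i} (\<lambda>_. count_space UNIV)) (subprob_algebra (count_space UNIV))"
    by (simp add: space_subprob_algebra measure_pmf.subprob_space_axioms)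
qed

lemma sets_mdp_measure:
  fixes \<nu> :: "'e::finite pmf" and q :: "'e \<times> 'a::finite \<Rightarrow> 'e pmf"
  shows "sets (mdp_measure \<nu> q \<sigma>) = sets (PiM UNIV (\<lambda>_. count_space UNIV))"
proof -
  interpret Ionescu_Tulcea "\<lambda>n \<omega>. measure_pmf (step_pmf \<nu> q \<sigma> n \<omega>)" "\<lambda>_. count_space UNIV"
    by (rule Ionescu_Tulcea_mdp)
  show ?thesis
    by (simp add: mdp_measure_def)
qed

lemma prob_space_mdp_measure:
  fixes \<nu> :: "'e::finite pmf" and q :: "'e \<times> 'a::finite \<Rightarrow> 'e pmf"
  shows "prob_space (mdp_measure \<nu> q \<sigma>)"
proof -
  interpret Ionescu_Tulcea "\<lambda>n \<omega>. measure_pmf (step_pmf \<nu> q \<sigma> n \<omega>)" "\<lambda>_. count_space UNIV"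
    by (rule Ionescu_Tulcea_mdp)
  have "emeasure PF.lim (space PF.lim) = 1"
    using lim[of "{}" "{\<lambda>_. undefined}"] prob_space.emeasure_space_1[OF PF.prob_space_P, of "{}"]
    by (simp add: PF.space_P PF.space_lim PiM_empty space_PiM prod_emb_def restrict_def vimage_def)
  then show ?thesis
    unfolding mdp_measure_def by (rule prob_spaceI)
qed

lemma measure_mdp_cylinder:
  fixes \<nu> :: "'e::finite pmf" and q :: "'e \<times> 'a::finite \<Rightarrow> 'e pmf"
  shows "measure (mdp_measure \<nu> q \<sigma>) {\<omega>. \<forall>k<n. \<omega> k = w k} = (\<Prod>k<n. pmf (step_pmf \<nu> q \<sigma> k w) (w k))"
proof -
  interpret Ionescu_Tulcea "\<lambda>n \<omega>. measure_pmf (step_pmf \<nu> q \<sigma> n \<omega>)" "\<lambda>_. count_space UNIV"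
    by (rule Ionescu_Tulcea_mdp)
  let ?M = "\<lambda>n. PiM {0..<n} (\<lambda>_. count_space UNIV) :: (nat \<Rightarrow> 'e \<times> 'a) measure"
  have M: "?M n = count_space (PiE {0..<n} (\<lambda>_. UNIV))" for n
    by (rule count_space_PiM_finite) auto
  have sets_w: "{restrict w {0..<n}} \<in> sets (?M n)" for n
    by (simp add: M)
  have eP: "emeasure (eP n x) {restrict w {0..<Suc n}} =
      ennreal (pmf (step_pmf \<nu> q \<sigma> n w) (w n)) * indicator {restrict w {0..<n}} x"
    if x: "x \<in> space (?M n)" for n x
  proof -
    have ext: "x \<in> extensional {0..<n}"
      using x by (simp add: space_PiM PiE_iff)
    have eq: "x(n := y) = restrict w {0..<Suc n} \<longleftrightarrow> x = restrict w {0..<n} \<and> y = w n" for y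
    proof
      assume *: "x(n := y) = restrict w {0..<Suc n}"
      have "x k = restrict w {0..<n} k" for k
        using fun_cong[OF *, of k] extensional_arb[OF ext, of k] by (cases k n rule: linorder_cases) auto
      then show "x = restrict w {0..<n} \<and> y = w n"
        using fun_cong[OF *, of n] by auto
    qed (auto simp: fun_eq_iff)
    have "emeasure (eP n x) {restrict w {0..<Suc n}} =
        emeasure (step_pmf \<nu> q \<sigma> n x) {y. x = restrict w {0..<n} \<and> y = w n}"
      by (subst emeasure_eP[OF x sets_w]) (simp add: vimage_def eq)
    also have "\<dots> = ennreal (pmf (step_pmf \<nu> q \<sigma> n w) (w n)) * indicator {restrict w {0..<n}} x"
    proof (cases "x = restrict w {0..<n}")
      case True
      then have "step_pmf \<nu> q \<sigma> n x = step_pmf \<nu> q \<sigma> n w"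
        by (intro step_pmf_cong) auto
      then show ?thesis
        using True by (simp add: emeasure_pmf_single)
    qed simp
    finally show ?thesis .
  qed
  have C: "emeasure (C 0 n (\<lambda>_. undefined)) {restrict w {0..<n}} =
      ennreal (\<Prod>k<n. pmf (step_pmf \<nu> q \<sigma> k w) (w k))" for n
  proof (induction n)
    case 0
    then show ?case
      by (simp add: PiM_empty restrict_def)
  next
    case (Suc n)
    let ?C = "C 0 n (\<lambda>_. undefined)"
    have space: "(\<lambda>_. undefined) \<in> space (?M 0)"
      by (simp add: space_PiM)
    have sC: "space ?C = space (?M n)" "sets ?C = sets (?M n)"
      using space_C[OF space, of n] sets_C[OF space, of n] by simp_all
    have "emeasure (C 0 (Suc n) (\<lambda>_. undefined)) {restrict w {0..<Suc n}} =
        (\<integral>\<^sup>+x. emeasure (eP n x) {restrict w {0..<Suc n}} \<partial>?C)"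
      using measurable_eP[of n] sets_w[of "Suc n"] prob_space.not_empty[OF prob_space_C[OF space, of n]]
      by (simp only: C.simps add_0)
         (intro emeasure_bind, auto simp: measurable_cong_sets[OF sC(2) refl])
    also have "\<dots> = (\<integral>\<^sup>+x. ennreal (pmf (step_pmf \<nu> q \<sigma> n w) (w n)) * indicator {restrict w {0..<n}} x \<partial>?C)"
      by (intro nn_integral_cong eP) (simp add: sC)
    also have "\<dots> = ennreal (pmf (step_pmf \<nu> q \<sigma> n w) (w n)) * emeasure ?C {restrict w {0..<n}}"
      using sets_w[of n] by (subst nn_integral_cmult_indicator) (auto simp: sC)
    also have "\<dots> = ennreal (\<Prod>k<Suc n. pmf (step_pmf \<nu> q \<sigma> k w) (w k))"
      by (simp add: Suc.IH ennreal_mult' prod_nonneg mult.commute)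
    finally show ?case .
  qed
  have "{\<omega>. \<forall>k<n. \<omega> k = w k} = prod_emb UNIV (\<lambda>_. count_space UNIV) {0..<n} {restrict w {0..<n}}"
    by (auto simp: prod_emb_def space_PiM fun_eq_iff restrict_def) metis
  then have "emeasure (mdp_measure \<nu> q \<sigma>) {\<omega>. \<forall>k<n. \<omega> k = w k} = emeasure (CI {0..<n}) {restrict w {0..<n}}"
    unfolding mdp_measure_def using lim[OF _ sets_w] by simp
  also have "\<dots> = emeasure (C 0 n (\<lambda>_. undefined)) {restrict w {0..<n}}"
    using sets.sets_into_space[OF sets_w]
    by (subst emeasure_CI[OF subset_refl sets_w]) (simp add: space_PiM prod_emb_id)
  also have "\<dots> = ennreal (\<Prod>k<n. pmf (step_pmf \<nu> q \<sigma> k w) (w k))"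
    by (rule C)
  finally show ?thesis
    by (simp add: measure_def prod_nonneg)
qed

lemma reward_law_in_prob_algebra:
  fixes \<nu> :: "'e::finite pmf" and q :: "'e \<times> 'a::finite \<Rightarrow> 'e pmf"
  shows "reward_law \<nu> q r \<beta> N \<sigma> \<in> space (prob_algebra borel)"
    and "reward_law_inf \<nu> q r \<beta> \<sigma> \<in> space (prob_algebra borel)"
proof -
  have r: "(\<lambda>\<omega>. r (\<omega> k)) \<in> borel_measurable (PiM UNIV (\<lambda>_. count_space UNIV))" for k :: nat
    by (rule measurable_compose[OF measurable_component_singleton]) auto
  have R: "reward r \<beta> n \<in> borel_measurable (mdp_measure \<nu> q \<sigma>)" for n
    unfolding reward_def[abs_def] measurable_cong_sets[OF sets_mdp_measure refl]
    by (intro borel_measurable_sum borel_measurable_times r) auto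
  have R_inf: "reward_inf r \<beta> \<in> borel_measurable (mdp_measure \<nu> q \<sigma>)"
    unfolding reward_inf_def[abs_def] by (intro borel_measurable_lim_metric R)
  show "reward_law \<nu> q r \<beta> N \<sigma> \<in> space (prob_algebra borel)"
    and "reward_law_inf \<nu> q r \<beta> \<sigma> \<in> space (prob_algebra borel)"
    unfolding reward_law_def reward_law_inf_def space_prob_algebra
    using prob_space.prob_space_distr[OF prob_space_mdp_measure R]
      prob_space.prob_space_distr[OF prob_space_mdp_measure R_inf] by auto
qed

lemma reward_inf_limit:
  fixes r :: "'e::finite \<times> 'a::finite \<Rightarrow> real"
  assumes "0 < \<beta>" "\<beta> < 1"
  shows "(\<lambda>n. reward r \<beta> n \<omega>) \<longlonglongrightarrow> reward_inf r \<beta> \<omega>"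
proof -
  have "summable (\<lambda>k. \<beta> ^ k * r (\<omega> k))"
  proof (rule summable_comparison_test')
    show "summable (\<lambda>k. \<beta> ^ k * Max (range (\<lambda>z. \<bar>r z\<bar>)))"
      using assms by (intro summable_mult2 summable_geometric) auto
    show "norm (\<beta> ^ k * r (\<omega> k)) \<le> \<beta> ^ k * Max (range (\<lambda>z. \<bar>r z\<bar>))" for k
      using assms by (auto simp: abs_mult intro!: mult_left_mono)
  qed
  then have "convergent (\<lambda>n. reward r \<beta> n \<omega>)"
    unfolding reward_def by (auto simp: convergent_def dest!: summable_LIMSEQ')
  then show ?thesis
    by (simp add: reward_inf_def convergent_LIMSEQ_iff)
qed

end

theory Submission
  imports Defs
begin

text \<open>Write \<open>J\<^sub>N \<sigma> = H (F\<^sub>N\<^sup>\<sigma>)\<close> and \<open>J\<^sub>\<infinity> \<sigma> = H (F\<^sub>\<infinity>\<^sup>\<sigma>)\<close>. The theorem rests on three facts about these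
  functions on the space of policies.

  The functions \<open>J\<^sub>N\<close> converge to \<open>J\<^sub>\<infinity>\<close> uniformly. The one-stage reward is bounded and future rewards are
  discounted, so the tail of the reward series is at most \<open>C \<beta>\<^sup>N\<^sup>+\<^sup>1 / (1 - \<beta>)\<close> on every path.
  The finite and the infinite horizon reward live on the same probability space, which is a coupling of
  their laws; hence the Wasserstein distance obeys the same bound for all policies at once
  (\<open>wasserstein1_reward_law_inf_le\<close>).

  Each \<open>J\<^sub>N\<close> is continuous. Only finitely many paths of length \<open>N + 1\<close> exist, and their probabilities are finite
  products of policy probabilities and transition probabilities, so the weights of the finitely supported
  law \<open>F\<^sub>N\<^sup>\<sigma>\<close> are continuous in \<open>\<sigma>\<close>. On a fixed finite support, convergence of the weights
  implies convergence in Wasserstein distance, because a coupling may leave the common mass in place and has to move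
  only the excess mass, over a bounded distance (\<open>wasserstein1_finite_support_le\<close>).

  The space of policies is sequentially compact, being a countable product of simplices
  (\<open>policy_seq_compact\<close>).

  Compactness and continuity give a maximiser of every \<open>J\<^sub>N\<close> and an accumulation point of these maximisers.
  Uniform convergence gives the convergence of the suprema, and it shows that every
  such accumulation point maximises \<open>J\<^sub>\<infinity>\<close>, which also settles the existence of an optimal policy
  for the infinite horizon.\<close>

section \<open>Upper bounds for the Wasserstein distance\<close>

text \<open>Two random variables on one probability space are a coupling of their laws.\<close>

lemma wasserstein1_distr_le:
  assumes M: "prob_space M"
    and [measurable]: "f \<in> borel_measurable M" "g \<in> borel_measurable M"
    and le: "\<And>x. x \<in> space M \<Longrightarrow> \<bar>f x - g x\<bar> \<le> c"
  shows "wasserstein1 (distr M borel f) (distr M borel g) \<le> ennreal c"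
proof -
  interpret prob_space M by fact
  define \<pi> where "\<pi> = distr M (borel \<Otimes>\<^sub>M borel) (\<lambda>x. (f x, g x))"
  have "prob_space \<pi>"
    unfolding \<pi>_def by (rule prob_space_distr) measurable
  moreover have "distr \<pi> borel fst = distr M borel f" "distr \<pi> borel snd = distr M borel g"
    unfolding \<pi>_def by (subst distr_distr; simp add: comp_def)+
  ultimately have "\<pi> \<in> couplings (distr M borel f) (distr M borel g)"
    unfolding couplings_def space_prob_algebra by (auto simp: \<pi>_def)
  then have "wasserstein1 (distr M borel f) (distr M borel g) \<le> (\<integral>\<^sup>+p. ennreal \<bar>fst p - snd p\<bar> \<partial>\<pi>)"
    unfolding wasserstein1_def by (rule INF_lower)
  also have "\<dots> = (\<integral>\<^sup>+x. ennreal \<bar>f x - g x\<bar> \<partial>M)"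
    unfolding \<pi>_def by (subst nn_integral_distr) auto
  also have "\<dots> \<le> (\<integral>\<^sup>+x. ennreal c \<partial>M)"
    by (intro nn_integral_mono ennreal_leI le)
  also have "\<dots> = ennreal c"
    by (simp add: emeasure_space_1)
  finally show ?thesis .
qed

lemma emeasure_finite_support:
  fixes F :: "real measure"
  assumes F: "F \<in> space (prob_algebra borel)" and S: "finite S" "measure F S = 1" and A: "A \<in> sets borel"
  shows "emeasure F A = ennreal (\<Sum>x\<in>S \<inter> A. measure F {x})"
proof -
  interpret prob_space F using F by (simp add: space_prob_algebra)
  have sets: "sets F = sets borel" using F by (simp add: space_prob_algebra)
  have SF: "S \<in> sets F" unfolding sets by (intro borel_closed finite_imp_closed S(1))
  have "AE x in F. x \<in> S"
    using AE_in_set_eq_1[OF SF] S(2) by simp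
  then have "measure F A = measure F (S \<inter> A)"
    using A sets SF by (intro finite_measure_eq_AE) auto
  also have "\<dots> = (\<Sum>x\<in>S \<inter> A. measure F {x})"
    using S(1) sets by (intro finite_measure_eq_sum_singleton) auto
  finally show ?thesis by (simp add: emeasure_eq_measure)
qed

text \<open>The coupling behind the bound is the maximal one: the common mass \<open>min (p x) (q x)\<close> stays on the
  diagonal, and the excesses \<open>a\<close> of \<open>F\<close> and \<open>b\<close> of \<open>G\<close>, which have the same total mass \<open>d\<close>, are coupled
  independently. Only the mass \<open>d\<close> moves, and it moves by at most \<open>2 * B\<close>.\<close>

lemma wasserstein1_finite_support_le:
  fixes F G :: "real measure"
  assumes F: "F \<in> space (prob_algebra borel)" and G: "G \<in> space (prob_algebra borel)"
    and S: "finite S" "measure F S = 1" "measure G S = 1"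
    and B: "\<And>x. x \<in> S \<Longrightarrow> \<bar>x\<bar> \<le> B"
  shows "wasserstein1 F G \<le> ennreal (2 * B * (\<Sum>x\<in>S. \<bar>measure F {x} - measure G {x}\<bar>))"
proof -
  interpret F: prob_space F using F by (simp add: space_prob_algebra)
  interpret G: prob_space G using G by (simp add: space_prob_algebra)
  have sets: "sets F = sets borel" "sets G = sets borel" using F G by (simp_all add: space_prob_algebra)
  define p q where "p x = measure F {x}" and "q x = measure G {x}" for x
  define a b where "a x = p x - min (p x) (q x)" and "b x = q x - min (p x) (q x)" for x
  define d where "d = sum a S"
  have ab: "0 \<le> a x" "0 \<le> b x" "0 \<le> p x" "0 \<le> q x" for x by (auto simp: a_def b_def p_def q_def)
  have sum1: "sum p S = 1" "sum q S = 1"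
    using F.finite_measure_eq_sum_singleton[OF S(1)] G.finite_measure_eq_sum_singleton[OF S(1)] S sets
    by (auto simp: p_def q_def)
  have d_b: "sum b S = d"
    by (simp add: d_def a_def b_def sum_subtractf sum1)
  have d0: "0 \<le> d" unfolding d_def by (intro sum_nonneg ab)
  \<comment> \<open>The case \<open>d = 0\<close> is \<open>F = G\<close>: nothing has to move, and the product part of \<open>c\<close> is \<open>0 / 0 = 0\<close>.\<close>
  have zero: "a x = 0" "b x = 0" if "d = 0" "x \<in> S" for x
    using that sum_nonneg_eq_0_iff[OF S(1), of a] sum_nonneg_eq_0_iff[OF S(1), of b] ab d_b by (auto simp: d_def)
  define c where "c = (\<lambda>(x, y). (if x = y then min (p x) (q x) else 0) + a x * b y / d)"
  have c0: "0 \<le> c z" for z using ab d0 by (auto simp: c_def split: prod.split)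
  have row: "(\<Sum>y\<in>S. c (x, y)) = p x" if "x \<in> S" for x
    using zero[of x] that S(1)
    by (cases "d = 0") (simp_all add: c_def sum.distrib sum.delta d_b a_def flip: sum_divide_distrib sum_distrib_left)
  have col: "(\<Sum>x\<in>S. c (x, y)) = q y" if "y \<in> S" for y
    using zero[of y] that S(1)
    by (cases "d = 0") (simp_all add: c_def sum.distrib sum.delta d_def[symmetric] b_def
        flip: sum_divide_distrib sum_distrib_right)
  define PM where "PM = point_measure (S \<times> S) (\<lambda>z. ennreal (c z))"
  have em: "emeasure PM X = ennreal (sum c X)" if "X \<subseteq> S \<times> S" for X
    using that S(1) c0 by (simp add: PM_def emeasure_point_measure_finite sum_ennreal)
  have spPM: "space PM = S \<times> S" "sets PM = Pow (S \<times> S)"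
    by (simp_all add: PM_def space_point_measure sets_point_measure)
  have meas [measurable]: "id \<in> measurable PM (borel \<Otimes>\<^sub>M borel :: (real \<times> real) measure)"
    "fst \<in> borel_measurable PM" "snd \<in> borel_measurable PM"
    by (auto simp: PM_def space_pair_measure)
  define \<pi> where "\<pi> = distr PM (borel \<Otimes>\<^sub>M borel) id"
  have "emeasure PM (space PM) = 1"
    using em[of "S \<times> S"] row sum1 by (simp add: spPM sum.cartesian_product')
  then have "prob_space PM" by (rule prob_spaceI)
  then have pr: "prob_space \<pi>" unfolding \<pi>_def by (rule prob_space.prob_space_distr) measurable
  have "distr \<pi> borel fst = distr PM borel fst" "distr \<pi> borel snd = distr PM borel snd"
    unfolding \<pi>_def by (subst distr_distr; simp add: comp_def)+
  moreover have "distr PM borel fst = F"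
  proof (rule measure_eqI)
    fix A assume "A \<in> sets (distr PM borel fst)"
    then have A: "A \<in> sets borel" by simp
    have "emeasure (distr PM borel fst) A = emeasure PM ((S \<inter> A) \<times> S)"
      using A by (subst emeasure_distr) (auto simp: spPM intro!: arg_cong[where f = "emeasure PM"])
    also have "\<dots> = ennreal (\<Sum>x\<in>S \<inter> A. \<Sum>y\<in>S. c (x, y))"
      by (subst em) (auto simp: sum.cartesian_product')
    also have "\<dots> = emeasure F A"
      using row by (simp add: emeasure_finite_support[OF F S(1,2) A] p_def)
    finally show "emeasure (distr PM borel fst) A = emeasure F A" .
  qed (simp add: sets)
  moreover have "distr PM borel snd = G"
  proof (rule measure_eqI)
    fix A assume "A \<in> sets (distr PM borel snd)"
    then have A: "A \<in> sets borel" by simp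
    have "emeasure (distr PM borel snd) A = emeasure PM (S \<times> (S \<inter> A))"
      using A by (subst emeasure_distr) (auto simp: spPM intro!: arg_cong[where f = "emeasure PM"])
    also have "\<dots> = ennreal (\<Sum>y\<in>S \<inter> A. \<Sum>x\<in>S. c (x, y))"
      by (subst em, force, subst sum.swap) (simp add: sum.cartesian_product')
    also have "\<dots> = emeasure G A"
      using col by (simp add: emeasure_finite_support[OF G S(1,3) A] q_def)
    finally show "emeasure (distr PM borel snd) A = emeasure G A" .
  qed (simp add: sets)
  ultimately have "\<pi> \<in> couplings F G"
    using pr unfolding couplings_def space_prob_algebra by (auto simp: \<pi>_def)
  then have "wasserstein1 F G \<le> (\<integral>\<^sup>+z. ennreal \<bar>fst z - snd z\<bar> \<partial>\<pi>)"
    unfolding wasserstein1_def by (rule INF_lower)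
  also have "\<dots> = (\<integral>\<^sup>+z. ennreal \<bar>fst z - snd z\<bar> \<partial>PM)"
    unfolding \<pi>_def by (subst nn_integral_distr) auto
  also have "\<dots> = (\<Sum>z\<in>S \<times> S. ennreal (c z) * ennreal \<bar>fst z - snd z\<bar>)"
    unfolding PM_def using S(1) by (subst nn_integral_point_measure_finite) auto
  also have "\<dots> = ennreal (\<Sum>z\<in>S \<times> S. c z * \<bar>fst z - snd z\<bar>)"
    using c0 by (simp add: sum_ennreal flip: ennreal_mult)
  also have "\<dots> \<le> ennreal (2 * B * d)"
  proof (rule ennreal_leI)
    have "(\<Sum>z\<in>S \<times> S. c z * \<bar>fst z - snd z\<bar>) \<le> (\<Sum>z\<in>S \<times> S. 2 * B * (a (fst z) * b (snd z) / d))"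
    proof (rule sum_mono)
      fix z assume "z \<in> S \<times> S"
      then obtain x y where z: "z = (x, y)" "x \<in> S" "y \<in> S" by auto
      have "c z * \<bar>x - y\<bar> = a x * b y / d * \<bar>x - y\<bar>"
        by (auto simp: c_def z)
      also have "\<dots> \<le> a x * b y / d * (2 * B)"
        using B[of x] B[of y] z ab d0 by (intro mult_left_mono) auto
      finally show "c z * \<bar>fst z - snd z\<bar> \<le> 2 * B * (a (fst z) * b (snd z) / d)"
        by (simp add: z mult.commute)
    qed
    also have "\<dots> = 2 * B * (\<Sum>x\<in>S. \<Sum>y\<in>S. a x * b y / d)"
      by (simp only: sum.cartesian_product split_def sum_distrib_left)
    also have "(\<Sum>x\<in>S. \<Sum>y\<in>S. a x * b y / d) = d"
    proof -
      have "(\<Sum>x\<in>S. \<Sum>y\<in>S. a x * b y / d) = sum a S * sum b S / d"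
        by (simp only: sum_product sum_divide_distrib)
      then show ?thesis by (simp add: d_b flip: d_def)
    qed
    finally show "(\<Sum>z\<in>S \<times> S. c z * \<bar>fst z - snd z\<bar>) \<le> 2 * B * d" .
  qed
  also have "\<dots> \<le> ennreal (2 * B * (\<Sum>x\<in>S. \<bar>p x - q x\<bar>))"
  proof -
    have "S \<noteq> {}" using sum1 by auto
    then have "0 \<le> B" using B by fastforce
    moreover have "d \<le> (\<Sum>x\<in>S. \<bar>p x - q x\<bar>)"
      unfolding d_def a_def by (intro sum_mono) auto
    ultimately show ?thesis by (intro ennreal_leI mult_left_mono) auto
  qed
  finally show ?thesis by (simp add: p_def q_def)
qed

section \<open>Truncation of the discounted reward\<close>

text \<open>The number \<open>t n\<close> is the tail \<open>\<Sum>k>n. \<beta>\<^sup>k C\<close> of the geometric series. Adding it to the partial sums of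
  the discounted reward gives a decreasing sequence and subtracting it gives an increasing one,
  so every partial sum is within \<open>t n\<close> of the limit.\<close>

lemma abs_reward_diff_le:
  fixes r :: "'e::finite \<times> 'a::finite \<Rightarrow> real"
  assumes \<beta>: "0 < \<beta>" "\<beta> < 1" and C: "\<And>z. \<bar>r z\<bar> \<le> C"
  shows "\<bar>reward r \<beta> N \<omega> - reward_inf r \<beta> \<omega>\<bar> \<le> C * \<beta> ^ Suc N / (1 - \<beta>)"
proof -
  define t where "t n = C * \<beta> ^ Suc n / (1 - \<beta>)" for n
  have step: "t n - t (Suc n) = \<beta> ^ Suc n * C" for n
  proof -
    have "t n - t (Suc n) = C * \<beta> ^ Suc n * (1 - \<beta>) / (1 - \<beta>)"
      by (simp add: t_def algebra_simps flip: diff_divide_distrib)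
    then show ?thesis using \<beta> by simp
  qed
  have "(\<lambda>n. C * \<beta> ^ Suc n / (1 - \<beta>)) \<longlonglongrightarrow> C * 0 / (1 - \<beta>)"
    using \<beta> by (intro tendsto_intros LIMSEQ_Suc[OF LIMSEQ_realpow_zero]) auto
  then have t0: "t \<longlonglongrightarrow> 0" by (simp add: t_def[abs_def])
  have bound: "\<bar>\<beta> ^ Suc n * r (\<omega> (Suc n))\<bar> \<le> \<beta> ^ Suc n * C" for n
    using \<beta> C[of "\<omega> (Suc n)"] by (simp only: abs_mult) (intro mult_mono, auto)
  have "(\<lambda>n. reward r \<beta> n \<omega> + t n) \<longlonglongrightarrow> reward_inf r \<beta> \<omega>"
    using tendsto_add[OF reward_inf_limit[OF \<beta>] t0] by simp
  moreover have "decseq (\<lambda>n. reward r \<beta> n \<omega> + t n)"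
    using step bound by (intro decseq_SucI) (simp add: reward_def, smt (verit))
  ultimately have "reward_inf r \<beta> \<omega> \<le> reward r \<beta> N \<omega> + t N"
    by (rule decseq_ge[rotated])
  moreover
  have "(\<lambda>n. reward r \<beta> n \<omega> - t n) \<longlonglongrightarrow> reward_inf r \<beta> \<omega>"
    using tendsto_diff[OF reward_inf_limit[OF \<beta>] t0] by simp
  moreover have "incseq (\<lambda>n. reward r \<beta> n \<omega> - t n)"
    using step bound by (intro incseq_SucI) (simp add: reward_def, smt (verit))
  ultimately have "reward r \<beta> N \<omega> - t N \<le> reward_inf r \<beta> \<omega>"
    by (intro incseq_le)
  with \<open>reward_inf r \<beta> \<omega> \<le> reward r \<beta> N \<omega> + t N\<close> show ?thesis
    unfolding t_def by linarith
qed

lemma borel_measurable_reward: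
  fixes \<nu> :: "'e::finite pmf" and q :: "'e \<times> 'a::finite \<Rightarrow> 'e pmf"
  shows "reward r \<beta> n \<in> borel_measurable (mdp_measure \<nu> q \<sigma>)"
    and "reward_inf r \<beta> \<in> borel_measurable (mdp_measure \<nu> q \<sigma>)"
proof -
  have r: "(\<lambda>\<omega>. r (\<omega> k)) \<in> borel_measurable (PiM UNIV (\<lambda>_. count_space UNIV))" for k :: nat
    by (rule measurable_compose[OF measurable_component_singleton]) auto
  show R: "reward r \<beta> n \<in> borel_measurable (mdp_measure \<nu> q \<sigma>)" for n
    unfolding reward_def[abs_def] measurable_cong_sets[OF sets_mdp_measure refl]
    by (intro borel_measurable_sum borel_measurable_times r) auto
  show "reward_inf r \<beta> \<in> borel_measurable (mdp_measure \<nu> q \<sigma>)"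
    unfolding reward_inf_def[abs_def] by (intro borel_measurable_lim_metric R)
qed

lemma wasserstein1_reward_law_inf_le:
  fixes \<nu> :: "'e::finite pmf" and q :: "'e \<times> 'a::finite \<Rightarrow> 'e pmf"
  assumes "0 < \<beta>" "\<beta> < 1" and "\<And>z. \<bar>r z\<bar> \<le> C"
  shows "wasserstein1 (reward_law \<nu> q r \<beta> N \<sigma>) (reward_law_inf \<nu> q r \<beta> \<sigma>)
    \<le> ennreal (C * \<beta> ^ Suc N / (1 - \<beta>))"
  unfolding reward_law_def reward_law_inf_def
  by (intro wasserstein1_distr_le prob_space_mdp_measure borel_measurable_reward abs_reward_diff_le assms)

section \<open>Continuity in the policy\<close>

text \<open>This is the form of every stage of the decision process: draw a state \<open>x\<close>, then an
  action from the decision rule at \<open>x\<close>. The probabilities of a stage are thus linear in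
  the policy.\<close>

lemma pmf_bind_map_Pair:
  fixes p :: "'e::finite pmf"
  shows "pmf (bind_pmf p (\<lambda>x. map_pmf (Pair x) (f x))) (y, a) = pmf p y * pmf (f y) a"
proof -
  have "pmf (map_pmf (Pair x) (f x)) (y, a) = (if x = y then pmf (f y) a else 0)" for x
  proof (cases "x = y")
    case True
    then show ?thesis by (simp add: pmf_map_inj' inj_on_def)
  next
    case False
    then have "(y, a) \<notin> set_pmf (map_pmf (Pair x) (f x))" by auto
    then show ?thesis using False by (simp only: set_pmf_iff) simp
  qed
  note pmf_map = this
  have "pmf (bind_pmf p (\<lambda>x. map_pmf (Pair x) (f x))) (y, a) =
      (\<Sum>x\<in>UNIV. pmf p x *\<^sub>R pmf (map_pmf (Pair x) (f x)) (y, a))"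
    unfolding pmf_bind by (rule integral_measure_pmf) auto
  also have "\<dots> = pmf p y * pmf (f y) a"
    unfolding pmf_map by (simp add: if_distrib sum.delta cong: if_cong)
  finally show ?thesis .
qed

lemma tendsto_pmf_step_pmf:
  fixes \<nu> :: "'e::finite pmf" and \<sigma> :: "('e, 'a::finite) policy"
  assumes "limitin policy_topology s \<sigma> F"
  shows "((\<lambda>i. pmf (step_pmf \<nu> q (s i) n \<omega>) z) \<longlongrightarrow> pmf (step_pmf \<nu> q \<sigma> n \<omega>) z) F"
proof -
  obtain x a where z: "z = (x, a)" by (cases z)
  show ?thesis
    using assms unfolding limitin_policy_topology_iff z step_pmf_def
    by (cases n) (auto simp: pmf_bind_map_Pair intro!: tendsto_intros)
qed

text \<open>The reward up to stage \<open>N\<close> depends only on the first \<open>N + 1\<close> state-action pairs, so the event that it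
  equals \<open>x\<close> is a finite disjoint union of cylinders. This makes the weights of the law explicit,
  as polynomials in the policy.\<close>

lemma measure_reward_law_singleton:
  fixes \<nu> :: "'e::finite pmf" and q :: "'e \<times> 'a::finite \<Rightarrow> 'e pmf"
  shows "measure (reward_law \<nu> q r \<beta> N \<sigma>) {x} =
    (\<Sum>w | w \<in> PiE {..N} (\<lambda>_. UNIV) \<and> reward r \<beta> N w = x. \<Prod>k<Suc N. pmf (step_pmf \<nu> q \<sigma> k w) (w k))"
proof -
  let ?M = "mdp_measure \<nu> q \<sigma>"
  let ?W = "{w. w \<in> PiE {..N} (\<lambda>_. UNIV) \<and> reward r \<beta> N w = x}"
  let ?cyl = "\<lambda>w. {\<omega>. \<forall>k<Suc N. \<omega> k = w k}"
  interpret M: prob_space ?M by (rule prob_space_mdp_measure)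
  have sp: "space ?M = UNIV"
    using sets_eq_imp_space_eq[OF sets_mdp_measure[of \<nu> q \<sigma>]] by (simp add: space_PiM)
  have fin: "finite ?W"
    by (rule finite_subset[of _ "PiE {..N} (\<lambda>_. UNIV)"]) (auto intro: finite_PiE)
  have eq: "{\<omega>. reward r \<beta> N \<omega> = x} = (\<Union>w\<in>?W. ?cyl w)"
  proof (intro equalityI subsetI)
    fix \<omega> assume "\<omega> \<in> {\<omega>. reward r \<beta> N \<omega> = x}"
    then have "restrict \<omega> {..N} \<in> ?W" by (simp add: reward_def)
    then show "\<omega> \<in> (\<Union>w\<in>?W. ?cyl w)" by (rule UN_I) auto
  next
    fix \<omega> assume "\<omega> \<in> (\<Union>w\<in>?W. ?cyl w)"
    then obtain w where "reward r \<beta> N w = x" "\<forall>k\<le>N. \<omega> k = w k" by (auto simp: less_Suc_eq_le)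
    then show "\<omega> \<in> {\<omega>. reward r \<beta> N \<omega> = x}" by (auto simp: reward_def)
  qed
  have cyl: "?cyl w \<in> sets ?M" for w
  proof -
    have "Measurable.pred (PiM UNIV (\<lambda>_. count_space UNIV)) (\<lambda>\<omega>. \<forall>k<Suc N. \<omega> k = w k)"
      by measurable
    then show ?thesis
      by (simp add: sets_mdp_measure pred_def space_PiM)
  qed
  have disj: "disjoint_family_on ?cyl ?W"
    unfolding disjoint_family_on_def
  proof (intro ballI impI)
    fix w w' assume w: "w \<in> ?W" "w' \<in> ?W" "w \<noteq> w'"
    then obtain k where k: "w k \<noteq> w' k" by (auto simp: fun_eq_iff)
    with w have "k \<le> N" by (cases "k \<le> N") (auto simp: PiE_iff extensional_def)
    with k show "?cyl w \<inter> ?cyl w' = {}" by (auto simp: less_Suc_eq_le)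
  qed
  have "measure (reward_law \<nu> q r \<beta> N \<sigma>) {x} = measure ?M {\<omega>. reward r \<beta> N \<omega> = x}"
    unfolding reward_law_def
    by (subst measure_distr[OF borel_measurable_reward(1)]) (auto simp: sp vimage_def)
  also have "\<dots> = (\<Sum>w\<in>?W. measure ?M (?cyl w))"
    unfolding eq using fin cyl disj by (intro M.finite_measure_finite_Union) auto
  finally show ?thesis by (simp only: measure_mdp_cylinder)
qed

text \<open>The laws under all policies share the finite support \<open>S\<close> of possible rewards, so that convergence
  of their weights suffices.\<close>

lemma wasserstein1_reward_law_tendsto_0:
  fixes \<nu> :: "'e::finite pmf" and \<sigma> :: "('e, 'a::finite) policy"
  assumes lim: "limitin policy_topology s \<sigma> F"
  shows "\<exists>e. (e \<longlongrightarrow> 0) F \<and>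
    (\<forall>i. wasserstein1 (reward_law \<nu> q r \<beta> N (s i)) (reward_law \<nu> q r \<beta> N \<sigma>) \<le> ennreal (e i))"
proof -
  let ?L = "reward_law \<nu> q r \<beta> N"
  define S where "S = reward r \<beta> N ` PiE {..N} (\<lambda>_. UNIV)"
  have fin: "finite S" unfolding S_def by (intro finite_imageI finite_PiE) auto
  have one: "measure (?L \<tau>) S = 1" for \<tau>
  proof -
    interpret M: prob_space "mdp_measure \<nu> q \<tau>" by (rule prob_space_mdp_measure)
    have "reward r \<beta> N \<omega> \<in> S" for \<omega>
    proof -
      have "reward r \<beta> N \<omega> = reward r \<beta> N (restrict \<omega> {..N})" by (simp add: reward_def)
      also have "\<dots> \<in> S" unfolding S_def by (rule imageI) (auto split: if_splits)
      finally show ?thesis .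
    qed
    then have "reward r \<beta> N -` S = UNIV" by auto
    then show ?thesis
      unfolding reward_law_def using fin M.prob_space
      by (subst measure_distr[OF borel_measurable_reward(1)]) (auto intro: borel_closed finite_imp_closed)
  qed
  define e where "e i = 2 * Max (abs ` S) * (\<Sum>x\<in>S. \<bar>measure (?L (s i)) {x} - measure (?L \<sigma>) {x}\<bar>)" for i
  have "wasserstein1 (?L (s i)) (?L \<sigma>) \<le> ennreal (e i)" for i
    unfolding e_def using fin one
    by (intro wasserstein1_finite_support_le reward_law_in_prob_algebra) auto
  moreover have "(e \<longlongrightarrow> 0) F"
  proof -
    have "((\<lambda>i. measure (?L (s i)) {x}) \<longlongrightarrow> measure (?L \<sigma>) {x}) F" for x
      unfolding measure_reward_law_singleton by (intro tendsto_intros tendsto_pmf_step_pmf lim)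
    then have "(e \<longlongrightarrow> 2 * Max (abs ` S) * (\<Sum>x\<in>S. \<bar>measure (?L \<sigma>) {x} - measure (?L \<sigma>) {x}\<bar>)) F"
      unfolding e_def by (intro tendsto_intros)
    then show ?thesis by simp
  qed
  ultimately show ?thesis by blast
qed

section \<open>Compactness of the policy space and maximisers\<close>

text \<open>A policy is a point of the cube of functions from (history, action) pairs to \<open>{0..1}\<close>. There are only
  countably many histories, so the cube is compact and first countable, hence sequentially compact. Since
  there are finitely many actions, no mass is lost in the limit, which is again a policy.\<close>

lemma policy_seq_compact:
  fixes s :: "nat \<Rightarrow> ('e::finite, 'a::finite) policy"
  obtains \<phi> \<sigma> where "strict_mono \<phi>" "limitin policy_topology (s \<circ> \<phi>) \<sigma> sequentially"
proof -
  define f :: "nat \<Rightarrow> ('e, 'a) hist \<times> 'a \<Rightarrow> real" where "f n = (\<lambda>(h, a). pmf (s n h) a)" for n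
  define C :: "(('e, 'a) hist \<times> 'a \<Rightarrow> real) set" where "C = PiE UNIV (\<lambda>_. {0..1})"
  have "compactin (product_topology (\<lambda>_. euclidean) UNIV) C"
    unfolding C_def by (subst compactin_PiE) simp
  then have "compact C" by (simp add: euclidean_product_topology)
  then have "seq_compact C" by (rule compact_imp_seq_compact)
  moreover have "f n \<in> C" for n by (auto simp: f_def C_def pmf_le_1)
  ultimately obtain l \<phi> where l: "l \<in> C" "strict_mono \<phi>" "(f \<circ> \<phi>) \<longlonglongrightarrow> l"
    unfolding seq_compact_def by metis
  have lim: "(\<lambda>n. pmf (s (\<phi> n) h) a) \<longlonglongrightarrow> l (h, a)" for h a
    using continuous_on_tendsto_compose[OF continuous_on_product_coordinates[of "(h, a)"] l(3)]
    by (simp add: f_def)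
  have nonneg: "0 \<le> l (h, a)" for h a using l(1) by (simp add: C_def PiE_iff del: split_paired_All)
  have "(\<Sum>a\<in>UNIV. l (h, a)) = 1" for h
  proof (rule LIMSEQ_unique)
    show "(\<lambda>n. \<Sum>a\<in>UNIV. pmf (s (\<phi> n) h) a) \<longlonglongrightarrow> (\<Sum>a\<in>UNIV. l (h, a))"
      by (intro tendsto_sum lim)
    show "(\<lambda>n. \<Sum>a\<in>UNIV. pmf (s (\<phi> n) h) a) \<longlonglongrightarrow> 1"
      by (simp add: sum_pmf_eq_1)
  qed
  then have "pmf (embed_pmf (\<lambda>a. l (h, a))) a = l (h, a)" for h a
    by (intro pmf_embed_pmf nonneg) (simp add: nn_integral_count_space_finite sum_ennreal nonneg)
  with lim have "limitin policy_topology (s \<circ> \<phi>) (\<lambda>h. embed_pmf (\<lambda>a. l (h, a))) sequentially"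
    by (simp add: limitin_policy_topology_iff)
  with l(2) show thesis by (rule that)
qed

lemma optimal_policies_iff: "\<sigma> \<in> optimal_policies J \<longleftrightarrow> (\<forall>\<sigma>'. J \<sigma>' \<le> J \<sigma>)"
proof
  assume "\<sigma> \<in> optimal_policies J"
  then have "ereal (J \<sigma>') \<le> ereal (J \<sigma>)" for \<sigma>'
    unfolding optimal_policies_def by (auto intro: SUP_upper)
  then show "\<forall>\<sigma>'. J \<sigma>' \<le> J \<sigma>" by simp
next
  assume "\<forall>\<sigma>'. J \<sigma>' \<le> J \<sigma>"
  then show "\<sigma> \<in> optimal_policies J"
    unfolding optimal_policies_def by (auto intro!: antisym SUP_upper SUP_least)
qed

text \<open>A maximising sequence has a convergent subsequence, and continuity makes its limit a maximiser. As
  the value there is a real number, the extended real supremum is finite.\<close>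

lemma optimal_policies_nonempty:
  fixes J :: "('e::finite, 'a::finite) policy \<Rightarrow> real"
  assumes cont: "\<And>s \<sigma>. limitin policy_topology s \<sigma> sequentially \<Longrightarrow> (\<lambda>n. J (s n)) \<longlonglongrightarrow> J \<sigma>"
  shows "optimal_policies J \<noteq> {}"
proof -
  let ?A = "range (\<lambda>\<sigma>. ereal (J \<sigma>))"
  obtain f where f: "incseq f" "range f \<subseteq> ?A" "Sup ?A = (SUP i. f i)"
    using Sup_countable_SUP[of ?A] by auto
  have "\<forall>i. \<exists>\<sigma>. f i = ereal (J \<sigma>)" using f(2) by auto
  then obtain s where s: "\<And>i. f i = ereal (J (s i))" by metis
  obtain \<phi> \<sigma> where \<phi>: "strict_mono \<phi>" "limitin policy_topology (s \<circ> \<phi>) \<sigma> sequentially"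
    by (rule policy_seq_compact)
  have "(f \<circ> \<phi>) \<longlonglongrightarrow> Sup ?A"
    using LIMSEQ_subseq_LIMSEQ[OF LIMSEQ_SUP[OF f(1)] \<phi>(1)] f(3) by simp
  moreover have "(f \<circ> \<phi>) \<longlonglongrightarrow> ereal (J \<sigma>)"
    using cont[OF \<phi>(2)] by (simp add: comp_def s)
  ultimately have "ereal (J \<sigma>) = Sup ?A" by (rule LIMSEQ_unique[rotated])
  then show ?thesis by (auto simp: optimal_policies_def)
qed

text \<open>The uniform limit \<open>J_inf\<close> is continuous up to the error \<open>e M\<close> for every fixed \<open>M\<close>: along the convergent
  subsequence of maximisers, values of \<open>J_inf\<close> are compared with those of the continuous function
  \<open>J M\<close>, and \<open>M\<close> is sent to infinity at the end.\<close>

lemma Ls_optimal_policies_subset: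
  fixes J :: "nat \<Rightarrow> ('e::finite, 'a::finite) policy \<Rightarrow> real"
  assumes cont: "\<And>N s \<sigma>. limitin policy_topology s \<sigma> sequentially \<Longrightarrow> (\<lambda>n. J N (s n)) \<longlonglongrightarrow> J N \<sigma>"
    and close: "\<And>N \<sigma>. \<bar>J N \<sigma> - J_inf \<sigma>\<bar> \<le> e N" and e: "e \<longlonglongrightarrow> 0"
  shows "Ls (\<lambda>N. optimal_policies (J N)) \<subseteq> optimal_policies J_inf"
proof
  fix \<sigma> assume "\<sigma> \<in> Ls (\<lambda>N. optimal_policies (J N))"
  then obtain s \<phi> where s: "\<And>N \<sigma>'. J N \<sigma>' \<le> J N (s N)" and \<phi>: "strict_mono \<phi>"
    and lim: "limitin policy_topology (s \<circ> \<phi>) \<sigma> sequentially"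
    unfolding Ls_def optimal_policies_iff by auto
  have e\<phi>: "(\<lambda>n. e (\<phi> n)) \<longlonglongrightarrow> 0"
    using LIMSEQ_subseq_LIMSEQ[OF e \<phi>] by (simp add: comp_def)
  have "J_inf \<sigma>' \<le> J_inf \<sigma>" for \<sigma>'
  proof -
    have "J_inf \<sigma>' \<le> J M \<sigma> + e M" for M
    proof (rule LIMSEQ_le)
      show "(\<lambda>n. J_inf \<sigma>' - 2 * e (\<phi> n)) \<longlonglongrightarrow> J_inf \<sigma>'"
        using tendsto_diff[OF tendsto_const tendsto_mult_right_zero[OF e\<phi>]] by force
      show "(\<lambda>n. J M (s (\<phi> n)) + e M) \<longlonglongrightarrow> J M \<sigma> + e M"
        using cont[OF lim, of M] by (auto intro!: tendsto_intros simp: comp_def)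
      have "J_inf \<sigma>' - 2 * e (\<phi> n) \<le> J M (s (\<phi> n)) + e M" for n
        using close[of "\<phi> n" \<sigma>'] s[of "\<phi> n" \<sigma>'] close[of "\<phi> n" "s (\<phi> n)"] close[of M "s (\<phi> n)"] by linarith
      then show "\<exists>k. \<forall>n\<ge>k. J_inf \<sigma>' - 2 * e (\<phi> n) \<le> J M (s (\<phi> n)) + e M" by blast
    qed
    then have "J_inf \<sigma>' \<le> J_inf \<sigma> + 2 * e M" for M
      using close[of M \<sigma>] by (smt (verit))
    moreover have "(\<lambda>M. J_inf \<sigma> + 2 * e M) \<longlonglongrightarrow> J_inf \<sigma>"
      using tendsto_add[OF tendsto_const tendsto_mult_right_zero[OF e]] by force
    ultimately show ?thesis by (intro LIMSEQ_le_const) auto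
  qed
  then show "\<sigma> \<in> optimal_policies J_inf" by (simp add: optimal_policies_iff)
qed

lemma Ls_optimal_policies_nonempty:
  fixes J :: "nat \<Rightarrow> ('e::finite, 'a::finite) policy \<Rightarrow> real"
  assumes "\<And>N. optimal_policies (J N) \<noteq> {}"
  shows "Ls (\<lambda>N. optimal_policies (J N)) \<noteq> {}"
proof -
  have "\<forall>N. \<exists>\<sigma>. \<sigma> \<in> optimal_policies (J N)"
    using assms by blast
  then obtain s where s: "\<And>N. s N \<in> optimal_policies (J N)"
    by metis
  obtain \<phi> \<sigma> where "strict_mono \<phi>" "limitin policy_topology (s \<circ> \<phi>) \<sigma> sequentially"
    by (rule policy_seq_compact)
  with s have "\<sigma> \<in> Ls (\<lambda>N. optimal_policies (J N))"
    unfolding Ls_def by blast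
  then show ?thesis by blast
qed

lemma tendsto_if_abs_diff_le:
  fixes x b :: "'i \<Rightarrow> real"
  assumes "\<And>i. \<bar>x i - l\<bar> \<le> b i" and "(b \<longlongrightarrow> 0) F"
  shows "(x \<longlongrightarrow> l) F"
proof (rule LIM_zero_cancel, rule Lim_null_comparison)
  show "\<forall>\<^sub>F i in F. norm (x i - l) \<le> b i"
    using assms(1) by (intro always_eventually allI) simp
qed (rule assms(2))

text \<open>Working in the extended reals covers unbounded \<open>J_inf\<close> as well: adding the real number \<open>e N\<close> to an infinite
  supremum does not change it, so the sandwich \<open>?S - e N \<le> (SUP \<sigma>. J N \<sigma>) \<le> ?S + e N\<close> remains valid.\<close>

lemma tendsto_SUP_uniform:
  fixes J :: "nat \<Rightarrow> 'p \<Rightarrow> real"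
  assumes close: "\<And>N \<sigma>. \<bar>J N \<sigma> - J_inf \<sigma>\<bar> \<le> e N" and e: "e \<longlonglongrightarrow> 0"
  shows "(\<lambda>N. SUP \<sigma>. ereal (J N \<sigma>)) \<longlonglongrightarrow> (SUP \<sigma>. ereal (J_inf \<sigma>))"
proof (rule tendsto_sandwich)
  let ?S = "SUP \<sigma>. ereal (J_inf \<sigma>)"
  have le: "?S \<le> (SUP \<sigma>. ereal (J N \<sigma>)) + ereal (e N)" "(SUP \<sigma>. ereal (J N \<sigma>)) \<le> ?S + ereal (e N)" for N
  proof -
    have "ereal (J_inf \<sigma>) \<le> (SUP \<sigma>. ereal (J N \<sigma>)) + ereal (e N)" for \<sigma>
    proof -
      have "ereal (J_inf \<sigma>) \<le> ereal (J N \<sigma>) + ereal (e N)"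
        using close[of N \<sigma>] by auto
      also have "\<dots> \<le> (SUP \<sigma>. ereal (J N \<sigma>)) + ereal (e N)"
        by (intro add_right_mono SUP_upper) simp
      finally show ?thesis .
    qed
    then show "?S \<le> (SUP \<sigma>. ereal (J N \<sigma>)) + ereal (e N)"
      by (rule SUP_least)
    have "ereal (J N \<sigma>) \<le> ?S + ereal (e N)" for \<sigma>
    proof -
      have "ereal (J N \<sigma>) \<le> ereal (J_inf \<sigma>) + ereal (e N)"
        using close[of N \<sigma>] by auto
      also have "\<dots> \<le> ?S + ereal (e N)"
        by (intro add_right_mono SUP_upper) simp
      finally show ?thesis .
    qed
    then show "(SUP \<sigma>. ereal (J N \<sigma>)) \<le> ?S + ereal (e N)"
      by (rule SUP_least)
  qed
  show "\<forall>\<^sub>F N in sequentially. ?S - ereal (e N) \<le> (SUP \<sigma>. ereal (J N \<sigma>))"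
    using le(1) by (intro always_eventually allI) (simp add: ereal_minus_le)
  show "\<forall>\<^sub>F N in sequentially. (SUP \<sigma>. ereal (J N \<sigma>)) \<le> ?S + ereal (e N)"
    using le(2) by simp
  have e': "(\<lambda>N. ereal (e N)) \<longlonglongrightarrow> 0"
    using e by (simp add: zero_ereal_def)
  show "(\<lambda>N. ?S - ereal (e N)) \<longlonglongrightarrow> ?S"
    using tendsto_diff_ereal_general[OF tendsto_const e', of ?S] by simp
  show "(\<lambda>N. ?S + ereal (e N)) \<longlonglongrightarrow> ?S"
    using tendsto_add_ereal_general1[OF _ tendsto_const e', of ?S]
      tendsto_add_ereal_general2[OF _ tendsto_const e', of ?S] by simp
qed

section \<open>Approximation of the infinite horizon problem\<close>

theorem theorem4p2:
  fixes \<nu> :: "'e::finite pmf"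
    and q :: "'e \<times> 'a::finite \<Rightarrow> 'e pmf"
    and r :: "'e \<times> 'a \<Rightarrow> real"
    and \<beta> :: real
    and H :: "real measure \<Rightarrow> real"
  assumes \<beta>: "0 < \<beta>" "\<beta> < 1"
    and H_Lipschitz: "\<exists>K>0. \<forall>F\<in>space (prob_algebra borel). \<forall>G\<in>space (prob_algebra borel).
          ennreal \<bar>H F - H G\<bar> \<le> ennreal K * wasserstein1 F G"
  shows "((\<forall>\<sigma>. convergent (\<lambda>N. H (reward_law \<nu> q r \<beta> N \<sigma>))) \<and>
      (\<lambda>N. SUP \<sigma>. ereal (H (reward_law \<nu> q r \<beta> N \<sigma>)))
         \<longlonglongrightarrow> (SUP \<sigma>. ereal (lim (\<lambda>N. H (reward_law \<nu> q r \<beta> N \<sigma>)))) \<and>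
      (SUP \<sigma>. ereal (lim (\<lambda>N. H (reward_law \<nu> q r \<beta> N \<sigma>)))) =
        (SUP \<sigma>. ereal (H (reward_law_inf \<nu> q r \<beta> \<sigma>)))) \<and>
    ((\<exists>\<sigma>opt. ereal (H (reward_law_inf \<nu> q r \<beta> \<sigma>opt)) = (SUP \<sigma>. ereal (H (reward_law_inf \<nu> q r \<beta> \<sigma>)))) \<and>
      {} \<noteq> Ls (\<lambda>N. optimal_policies (\<lambda>\<sigma>. H (reward_law \<nu> q r \<beta> N \<sigma>))) \<and>
      Ls (\<lambda>N. optimal_policies (\<lambda>\<sigma>. H (reward_law \<nu> q r \<beta> N \<sigma>)))
        \<subseteq> optimal_policies (\<lambda>\<sigma>. H (reward_law_inf \<nu> q r \<beta> \<sigma>)))"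
proof -
  let ?L = "reward_law \<nu> q r \<beta>" and ?L_inf = "reward_law_inf \<nu> q r \<beta>"
  obtain K where K: "0 < K" and Lip: "\<And>F G. F \<in> space (prob_algebra borel) \<Longrightarrow> G \<in> space (prob_algebra borel) \<Longrightarrow>
      ennreal \<bar>H F - H G\<bar> \<le> ennreal K * wasserstein1 F G"
    using H_Lipschitz by blast
  \<comment> \<open>The maximum with 0 is there because \<open>ennreal\<close> maps negative numbers to 0.\<close>
  have H_close: "\<bar>H F - H G\<bar> \<le> K * max 0 c"
    if "F \<in> space (prob_algebra borel)" "G \<in> space (prob_algebra borel)" "wasserstein1 F G \<le> ennreal c" for F G c
  proof -
    have "ennreal \<bar>H F - H G\<bar> \<le> ennreal K * ennreal c"
      using Lip[OF that(1,2)] mult_left_mono[OF that(3), of "ennreal K"] by (simp add: order_trans)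
    also have "\<dots> = ennreal (K * max 0 c)"
      using K by (simp add: ennreal_mult max_def ennreal_neg)
    finally show ?thesis using K by (subst (asm) ennreal_le_iff) auto
  qed
  define C where "C = Max (range (\<lambda>z. \<bar>r z\<bar>))"
  have C: "\<bar>r z\<bar> \<le> C" for z unfolding C_def by auto
  define e where "e N = K * max 0 (C * \<beta> ^ Suc N / (1 - \<beta>))" for N
  have close: "\<bar>H (?L N \<sigma>) - H (?L_inf \<sigma>)\<bar> \<le> e N" for N \<sigma>
    unfolding e_def
    by (intro H_close reward_law_in_prob_algebra wasserstein1_reward_law_inf_le \<beta> C)
  have "e \<longlonglongrightarrow> K * max 0 (C * 0 / (1 - \<beta>))"
    unfolding e_def using \<beta> by (intro tendsto_intros LIMSEQ_Suc[OF LIMSEQ_realpow_zero]) auto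
  then have e: "e \<longlonglongrightarrow> 0" by simp
  have cont: "(\<lambda>n. H (?L N (s n))) \<longlonglongrightarrow> H (?L N \<sigma>)"
    if conv: "limitin policy_topology s \<sigma> sequentially" for N s \<sigma>
  proof -
    obtain d where d: "d \<longlonglongrightarrow> 0" "\<And>i. wasserstein1 (?L N (s i)) (?L N \<sigma>) \<le> ennreal (d i)"
      using wasserstein1_reward_law_tendsto_0[OF conv] by blast
    have "(\<lambda>i. K * max 0 (d i)) \<longlonglongrightarrow> K * max 0 0"
      by (intro tendsto_mult tendsto_max tendsto_const d(1))
    then have "(\<lambda>i. K * max 0 (d i)) \<longlonglongrightarrow> 0" by simp
    moreover have "\<bar>H (?L N (s i)) - H (?L N \<sigma>)\<bar> \<le> K * max 0 (d i)" for i
      by (intro H_close reward_law_in_prob_algebra d(2))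
    ultimately show ?thesis by (rule tendsto_if_abs_diff_le[rotated])
  qed
  have lim: "(\<lambda>N. H (?L N \<sigma>)) \<longlonglongrightarrow> H (?L_inf \<sigma>)" for \<sigma>
    by (rule tendsto_if_abs_diff_le[OF close e])
  have sub: "Ls (\<lambda>N. optimal_policies (\<lambda>\<sigma>. H (?L N \<sigma>))) \<subseteq> optimal_policies (\<lambda>\<sigma>. H (?L_inf \<sigma>))"
    by (rule Ls_optimal_policies_subset[OF cont close e])
  have ne: "Ls (\<lambda>N. optimal_policies (\<lambda>\<sigma>. H (?L N \<sigma>))) \<noteq> {}"
    by (rule Ls_optimal_policies_nonempty[OF optimal_policies_nonempty[OF cont]])
  from sub ne obtain \<sigma>opt where "\<sigma>opt \<in> optimal_policies (\<lambda>\<sigma>. H (?L_inf \<sigma>))" by blast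
  then have "\<exists>\<sigma>opt. ereal (H (?L_inf \<sigma>opt)) = (SUP \<sigma>. ereal (H (?L_inf \<sigma>)))"
    by (auto simp: optimal_policies_def)
  moreover have "\<forall>\<sigma>. convergent (\<lambda>N. H (?L N \<sigma>))"
    using lim by (auto simp: convergent_def)
  ultimately show ?thesis
    using tendsto_SUP_uniform[OF close e] sub ne by (simp add: limI[OF lim])
qed

end
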